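(* The Riemannian manifolds $\mathbb{S}^2_\kappa\times\mathbb{R}$ (with $\kappa>0$), $Nil_3(\kappa,\tau)$ (with $\kappa=0$, $\tau\neq0$) and $\widetilde{PSl_2}(\kappa,\tau)$ (with $\kappa<0$, $\tau\neq0$) do not carry a (gradient) quasi-Einstein structure. That is, if $(M^3,g)$ is any one of them, there do not exist a smooth function $f:M\to\mathbb{R}$ and constants $0<m\le\infty$, $\lambda\in\mathbb{R}$ such that $$Ric+\nabla^2 f-\frac1m\,df\otimes df=\lambda g .$$
   Context: $Ric$ is the Ricci tensor and $\nabla^2 f$ the Hessian of $f$ with respect to $g$; for $m=\infty$ the term $\frac1m df\otimes df$ is absent and the equation is that of a gradient Ricci soliton. $\mathbb{S}^2_\kappa\times\mathbb{R}$ is the Riemannian product of the round $2$-sphere of constant curvature $\kappa>0$ with the real line. $Nil_3(\kappa,\tau)$, with $\kappa=0$ and $\tau\ne0$, is $\mathbb{R}^3$ with coordinates $(x,y,t)$ and metric $g=dx^2+dy^2+[\tau(x\,dy-y\,dx)+dt]^2$ (Heisenberg space). For $\kappa<0$ and $\tau\neq0$, $\widetilde{PSl_2}(\kappa,\tau)$ is the universal cover of the Lie group $PSl_2$ with a left-invariant metric, described on $\{(x,y,t)\in\mathbb{R}^3: 1+\kappa(x^2+y^2)>0\}$ by $g=\rho^2(dx^2+dy^2)+[2\kappa\tau\rho\,(y\,dx-x\,dy)+dt]^2$, where $\rho=\frac{2}{1+\kappa(x^2+y^2)}$.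
   Formalization: For S²_κ×R the case m=∞, λ=κ is excluded, because there the claim is false: f=κt²/2 gives Ric+∇²f=κg (the shrinking cylinder soliton); all other m and λ are covered, and the other two spaces have no exception. *)

theory Defs
  imports "HOL-Analysis.Analysis" "HOL-Library.Extended_Real"
begin

section \<open>Tensor calculus in a chart\<close>

text \<open>Directional derivative; on the open domains below, where the functions are differentiable,
  it is linear in the direction v.\<close>

definition dir_deriv ::
  "('a::euclidean_space \<Rightarrow> 'b::real_normed_vector) \<Rightarrow> 'a \<Rightarrow> 'a \<Rightarrow> 'b" where
  "dir_deriv h x v = frechet_derivative h (at x) v"

primrec Ck_on :: "nat \<Rightarrow> ('a::euclidean_space \<Rightarrow> 'b::real_normed_vector) \<Rightarrow> 'a set \<Rightarrow> bool" where
  "Ck_on 0 h U \<longleftrightarrow> continuous_on U h"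
| "Ck_on (Suc k) h U \<longleftrightarrow>
     (\<forall>x\<in>U. h differentiable (at x)) \<and> (\<forall>v. Ck_on k (\<lambda>x. dir_deriv h x v) U)"

definition smooth_on :: "('a::euclidean_space \<Rightarrow> 'b::real_normed_vector) \<Rightarrow> 'a set \<Rightarrow> bool" where
  "smooth_on h U \<longleftrightarrow> (\<forall>k. Ck_on k h U)"

text \<open>A metric tensor on a chart domain assigns a bilinear form to every point.
  The vector arguments u, v, w, z below stand for constant-coefficient (hence pairwise commuting)
  vector fields on the chart domain.\<close>

type_synonym 'a metric = "'a \<Rightarrow> 'a \<Rightarrow> 'a \<Rightarrow> real"

text \<open>The Koszul formula for commuting fields, i.e. the Christoffel symbols of the first kind.\<close>

definition koszul :: "('a::euclidean_space) metric \<Rightarrow> 'a \<Rightarrow> 'a \<Rightarrow> 'a \<Rightarrow> 'a \<Rightarrow> real" where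
  "koszul g x u v z =
     (dir_deriv (\<lambda>y. g y v z) x u + dir_deriv (\<lambda>y. g y u z) x v - dir_deriv (\<lambda>y. g y u v) x z) / 2"

text \<open>Levi-Civita connection: the covariant derivative of the constant field v along u.
  In coordinates this is the vector with components \<open>\<Gamma>\<^sup>k\<^sub>i\<^sub>j u\<^sup>i v\<^sup>j\<close>.\<close>

definition christoffel :: "('a::euclidean_space) metric \<Rightarrow> 'a \<Rightarrow> 'a \<Rightarrow> 'a \<Rightarrow> 'a" where
  "christoffel g x u v = (THE w. \<forall>z. g x w z = koszul g x u v z)"

text \<open>\<open>R(u,v)w = \<nabla>\<^sub>u\<nabla>\<^sub>v w - \<nabla>\<^sub>v\<nabla>\<^sub>u w\<close>\<close>

definition riemann :: "('a::euclidean_space) metric \<Rightarrow> 'a \<Rightarrow> 'a \<Rightarrow> 'a \<Rightarrow> 'a \<Rightarrow> 'a" where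
  "riemann g x u v w =
     dir_deriv (\<lambda>y. christoffel g y v w) x u - dir_deriv (\<lambda>y. christoffel g y u w) x v
     + christoffel g x u (christoffel g x v w) - christoffel g x v (christoffel g x u w)"

text \<open>\<open>Ric(v,w) = trace (u \<mapsto> R(u,v)w)\<close>; the trace does not depend on the basis.\<close>

definition ricci :: "('a::euclidean_space) metric \<Rightarrow> 'a \<Rightarrow> 'a \<Rightarrow> 'a \<Rightarrow> real" where
  "ricci g x v w = (\<Sum>b\<in>Basis. riemann g x b v w \<bullet> b)"

definition hessian ::
  "('a::euclidean_space) metric \<Rightarrow> ('a \<Rightarrow> real) \<Rightarrow> 'a \<Rightarrow> 'a \<Rightarrow> 'a \<Rightarrow> real" where
  "hessian g h x u v =
     dir_deriv (\<lambda>y. dir_deriv h y v) x u - dir_deriv h x (christoffel g x u v)"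


section \<open>Riemannian manifolds given by an atlas\<close>

text \<open>A chart is given by its inverse: a parametrisation, injective on an open domain, of a part of
  the manifold, together with the metric tensor in these coordinates. A Riemannian manifold is
  given by a family of charts whose images cover it.\<close>

datatype ('a, 'p) chart = Chart (dom: "'a set") (par: "'a \<Rightarrow> 'p") (met: "'a metric")

definition quasi_einstein ::
  "('a::euclidean_space, 'p) chart set \<Rightarrow> ereal \<Rightarrow> real \<Rightarrow> ('p \<Rightarrow> real) \<Rightarrow> bool" where
  "quasi_einstein M m l f \<longleftrightarrow>
     (\<forall>c\<in>M. smooth_on (f \<circ> par c) (dom c) \<and>
       (\<forall>x\<in>dom c. \<forall>u v.
          ricci (met c) x u v + hessian (met c) (f \<circ> par c) x u v
          - real_of_ereal (1 / m) * (dir_deriv (f \<circ> par c) x u * dir_deriv (f \<circ> par c) x v)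
          = l * met c x u v))"

lemma quasi_einstein_infinity:
  "quasi_einstein M \<infinity> l f \<longleftrightarrow>
     (\<forall>c\<in>M. smooth_on (f \<circ> par c) (dom c) \<and>
       (\<forall>x\<in>dom c. \<forall>u v.
          ricci (met c) x u v + hessian (met c) (f \<circ> par c) x u v = l * met c x u v))"
  by (simp add: quasi_einstein_def)

fun product_chart ::
  "('a::euclidean_space, 'p) chart \<Rightarrow> ('b::euclidean_space, 'q) chart \<Rightarrow> ('a \<times> 'b, 'p \<times> 'q) chart"
where
  "product_chart (Chart U \<phi> g) (Chart V \<psi> h) =
     Chart (U \<times> V) (map_prod \<phi> \<psi>)
       (\<lambda>x u v. g (fst x) (fst u) (fst v) + h (snd x) (snd u) (snd v))"

definition product_manifold ::
  "('a::euclidean_space, 'p) chart set \<Rightarrow> ('b::euclidean_space, 'q) chart set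
    \<Rightarrow> ('a \<times> 'b, 'p \<times> 'q) chart set" where
  "product_manifold M N = {product_chart c d |c d. c \<in> M \<and> d \<in> N}"

definition induced_metric :: "('a::euclidean_space \<Rightarrow> 'p::euclidean_space) \<Rightarrow> 'a metric" where
  "induced_metric \<phi> x u v = dir_deriv \<phi> x u \<bullet> dir_deriv \<phi> x v"


section \<open>The three families\<close>

definition real_line :: "(real, real) chart set" where
  "real_line = {Chart UNIV id (\<lambda>x u v. u * v)}"

definition rho :: "real \<Rightarrow> real \<Rightarrow> real \<Rightarrow> real" where
  "rho \<kappa> x y = 2 / (1 + \<kappa> * (x\<^sup>2 + y\<^sup>2))"

text \<open>For \<open>s = 1\<close> and \<open>s = -1\<close>, the inverse stereographic projections onto the sphere of radius
  \<open>1 / sqrt \<kappa>\<close> without one of its two poles (rescaled so that the induced metric is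
  \<open>rho\<^sup>2 (dx\<^sup>2 + dy\<^sup>2)\<close>).\<close>

definition stereo :: "real \<Rightarrow> real \<Rightarrow> real \<times> real \<Rightarrow> real \<times> real \<times> real" where
  "stereo \<kappa> s = (\<lambda>(x, y). (rho \<kappa> x y * x, rho \<kappa> x y * y, s * (1 - rho \<kappa> x y) / sqrt \<kappa>))"

definition round_sphere :: "real \<Rightarrow> (real \<times> real, real \<times> real \<times> real) chart set" where
  "round_sphere \<kappa> = {Chart UNIV (stereo \<kappa> s) (induced_metric (stereo \<kappa> s)) |s. s \<in> {1, -1}}"

definition S2_times_R ::
  "real \<Rightarrow> ((real \<times> real) \<times> real, (real \<times> real \<times> real) \<times> real) chart set" where
  "S2_times_R \<kappa> = product_manifold (round_sphere \<kappa>) real_line"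

definition nil_metric :: "real \<Rightarrow> (real \<times> real \<times> real) metric" where
  "nil_metric \<tau> = (\<lambda>(x, y, t) (u1, u2, u3) (v1, v2, v3).
     u1 * v1 + u2 * v2 + (\<tau> * (x * u2 - y * u1) + u3) * (\<tau> * (x * v2 - y * v1) + v3))"

definition Nil3 :: "real \<Rightarrow> (real \<times> real \<times> real, real \<times> real \<times> real) chart set" where
  "Nil3 \<tau> = {Chart UNIV id (nil_metric \<tau>)}"

definition psl2_metric :: "real \<Rightarrow> real \<Rightarrow> (real \<times> real \<times> real) metric" where
  "psl2_metric \<kappa> \<tau> = (\<lambda>(x, y, t) (u1, u2, u3) (v1, v2, v3).
     (rho \<kappa> x y)\<^sup>2 * (u1 * v1 + u2 * v2)
     + (2 * \<kappa> * \<tau> * rho \<kappa> x y * (y * u1 - x * u2) + u3)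
       * (2 * \<kappa> * \<tau> * rho \<kappa> x y * (y * v1 - x * v2) + v3))"

definition PSL2_cover ::
  "real \<Rightarrow> real \<Rightarrow> (real \<times> real \<times> real, real \<times> real \<times> real) chart set" where
  "PSL2_cover \<kappa> \<tau> =
     {Chart {(x, y, t). 1 + \<kappa> * (x\<^sup>2 + y\<^sup>2) > 0} id (psl2_metric \<kappa> \<tau>)}"


section \<open>The round cylinder\<close>

lemma rho_pos:
  assumes "\<kappa> > 0"
  shows "rho \<kappa> x y > 0" "1 + \<kappa> * (x\<^sup>2 + y\<^sup>2) > 0"
proof -
  show "1 + \<kappa> * (x\<^sup>2 + y\<^sup>2) > 0"
    using assms by (intro add_pos_nonneg mult_nonneg_nonneg) auto
  then show "rho \<kappa> x y > 0" by (simp add: rho_def)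
qed

lemma rho_eq:
  assumes "\<kappa> > 0"
  shows "rho \<kappa> x y * (\<kappa> * (x\<^sup>2 + y\<^sup>2)) = 2 - rho \<kappa> x y"
  using rho_pos(2)[OF assms, of x y] by (simp add: rho_def field_simps)

lemma round_sphere_covers:
  assumes "\<kappa> > 0"
  shows "(\<Union>c\<in>round_sphere \<kappa>. par c ` dom c) = sphere 0 (1 / sqrt \<kappa>)"
proof (intro equalityI subsetI)
  have sq: "norm (a, b, c) = 1 / sqrt \<kappa> \<longleftrightarrow> \<kappa> * (a\<^sup>2 + b\<^sup>2 + c\<^sup>2) = 1" for a b c :: real
  proof -
    have "norm (a, b, c) = sqrt (a\<^sup>2 + b\<^sup>2 + c\<^sup>2)"
      by (simp add: norm_Pair add.assoc)
    moreover have "1 / sqrt \<kappa> = sqrt (1 / \<kappa>)" by (simp add: real_sqrt_divide)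
    moreover have "sqrt (a\<^sup>2 + b\<^sup>2 + c\<^sup>2) = sqrt (1 / \<kappa>) \<longleftrightarrow> a\<^sup>2 + b\<^sup>2 + c\<^sup>2 = 1 / \<kappa>"
      by (rule real_sqrt_eq_iff)
    ultimately have "norm (a, b, c) = 1 / sqrt \<kappa> \<longleftrightarrow> a\<^sup>2 + b\<^sup>2 + c\<^sup>2 = 1 / \<kappa>"
      by (simp only:)
    also have "\<dots> \<longleftrightarrow> \<kappa> * (a\<^sup>2 + b\<^sup>2 + c\<^sup>2) = 1" using assms by (simp add: field_simps)
    finally show ?thesis .
  qed
  {
    fix q assume "q \<in> (\<Union>c\<in>round_sphere \<kappa>. par c ` dom c)"
    then obtain c where "c \<in> round_sphere \<kappa>" and qc: "q \<in> par c ` dom c" by blast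
    then obtain s where s: "s = 1 \<or> s = -1"
      and c: "c = Chart UNIV (stereo \<kappa> s) (induced_metric (stereo \<kappa> s))"
      unfolding round_sphere_def by blast
    obtain p where qp: "q = stereo \<kappa> s p" using qc by (auto simp only: c chart.sel)
    obtain x y where q: "q = stereo \<kappa> s (x, y)" using qp by (cases p) simp
    have s2: "s\<^sup>2 = 1" using s by auto
    define r where "r = rho \<kappa> x y"
    have z: "(s * (1 - r) / sqrt \<kappa>)\<^sup>2 = (1 - r)\<^sup>2 / \<kappa>"
      using assms by (simp add: power_mult_distrib power_divide s2)
    have "\<kappa> * ((r * x)\<^sup>2 + (r * y)\<^sup>2 + (s * (1 - r) / sqrt \<kappa>)\<^sup>2)
        = r * (r * (\<kappa> * (x\<^sup>2 + y\<^sup>2))) + (1 - r)\<^sup>2"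
      unfolding z using assms by (simp add: distrib_left power2_eq_square mult.assoc mult.left_commute)
    also have "\<dots> = r * (2 - r) + (1 - r)\<^sup>2"
      unfolding r_def rho_eq[OF assms] ..
    also have "\<dots> = 1"
      by (simp add: power2_eq_square algebra_simps)
    finally show "q \<in> sphere 0 (1 / sqrt \<kappa>)"
      using sq by (simp add: q stereo_def r_def)
  next
    fix q :: "real \<times> real \<times> real"
    assume q: "q \<in> sphere 0 (1 / sqrt \<kappa>)"
    obtain a b c where abc: "q = (a, b, c)" by (cases q) auto
    have e: "\<kappa> * (a\<^sup>2 + b\<^sup>2 + c\<^sup>2) = 1" using q sq abc by simp
    define s :: real where "s = (if c > 0 then -1 else 1)"
    define r where "r = 1 - s * (sqrt \<kappa> * c)"
    have s2: "s * s = 1" by (simp add: s_def)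
    have r1: "r \<ge> 1" using assms by (auto simp: r_def s_def mult_nonneg_nonpos)
    have k2: "sqrt \<kappa> * sqrt \<kappa> = \<kappa>" using assms by simp
    have "(1 - r)\<^sup>2 = (s * s) * (sqrt \<kappa> * sqrt \<kappa>) * c\<^sup>2"
      by (simp add: r_def power2_eq_square)
    then have "(1 - r)\<^sup>2 = \<kappa> * c\<^sup>2" by (simp only: s2 k2 mult_1_left)
    with e have ab: "\<kappa> * (a\<^sup>2 + b\<^sup>2) = r * (2 - r)"
      by (simp add: power2_eq_square algebra_simps)
    have "1 + \<kappa> * ((a / r)\<^sup>2 + (b / r)\<^sup>2) = 1 + (\<kappa> * (a\<^sup>2 + b\<^sup>2)) / r\<^sup>2"
      by (simp add: power_divide add_divide_distrib algebra_simps)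
    also have "\<dots> = 2 / r"
      unfolding ab using r1 by (simp add: power2_eq_square field_simps)
    finally have "rho \<kappa> (a / r) (b / r) = r"
      by (simp add: rho_def)
    moreover have "s * (1 - r) / sqrt \<kappa> = c"
      using s2 assms by (simp add: r_def flip: mult.assoc)
    ultimately have "q = stereo \<kappa> s (a / r, b / r)"
      using r1 by (simp add: stereo_def abc)
    moreover have "s \<in> {1, -1}" by (simp add: s_def)
    ultimately show "q \<in> (\<Union>c\<in>round_sphere \<kappa>. par c ` dom c)"
      unfolding round_sphere_def
      by (intro UN_I[of "Chart UNIV (stereo \<kappa> s) (induced_metric (stereo \<kappa> s))"]) auto
  }
qed

lemma dir_deriv_eq: "(h has_derivative h') (at x) \<Longrightarrow> dir_deriv h x v = h' v"
  unfolding dir_deriv_def by (metis frechet_derivative_at)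

lemma rho_has_derivative:
  assumes "\<kappa> > 0"
    and "(X has_derivative X') (at x)" "(Y has_derivative Y') (at x)"
  shows "((\<lambda>p. rho \<kappa> (X p) (Y p)) has_derivative
     (\<lambda>u. - \<kappa> * (rho \<kappa> (X x) (Y x))\<^sup>2 * (X x * X' u + Y x * Y' u))) (at x)"
proof -
  have "((\<lambda>p. 2 / (1 + \<kappa> * ((X p)\<^sup>2 + (Y p)\<^sup>2))) has_derivative
     (\<lambda>u. - 2 * (\<kappa> * (2 * X x * X' u + 2 * Y x * Y' u)) / (1 + \<kappa> * ((X x)\<^sup>2 + (Y x)\<^sup>2))\<^sup>2)) (at x)"
    using rho_pos(2)[OF assms(1), of "X x" "Y x"]
    by (auto intro!: derivative_eq_intros assms(2,3) simp: power2_eq_square divide_simps algebra_simps)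
  then show ?thesis
    unfolding rho_def
    by (rule has_derivative_eq_rhs) (auto simp: fun_eq_iff power_divide add_divide_distrib diff_divide_distrib algebra_simps)
qed

lemma induced_metric_stereo:
  assumes k: "\<kappa> > 0" and s: "s \<in> {1, -1}"
  shows "induced_metric (stereo \<kappa> s) (x, y) (u1, u2) (v1, v2) =
    (rho \<kappa> x y)\<^sup>2 * (u1 * v1 + u2 * v2)"
proof -
  define r where "r = rho \<kappa> x y"
  define D where "D = (\<lambda>(u1, u2). - \<kappa> * r\<^sup>2 * (x * u1 + y * u2))"
  have D: "((\<lambda>p. rho \<kappa> (fst p) (snd p)) has_derivative D) (at (x, y))"
    unfolding D_def r_def
    by (rule has_derivative_eq_rhs[OF rho_has_derivative[OF k]])
       (auto intro!: derivative_eq_intros)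
  have st: "stereo \<kappa> s = (\<lambda>p. (rho \<kappa> (fst p) (snd p) * fst p, rho \<kappa> (fst p) (snd p) * snd p,
      s / sqrt \<kappa> * (1 - rho \<kappa> (fst p) (snd p))))"
    by (auto simp: stereo_def fun_eq_iff)
  have third: "((\<lambda>p. c * (1 - rho \<kappa> (fst p) (snd p))) has_derivative (\<lambda>u. - c * D u)) (at (x, y))"
    for c by (auto intro!: derivative_eq_intros D)
  have fs: "((\<lambda>p. rho \<kappa> (fst p) (snd p) * fst p) has_derivative (\<lambda>u. D u * x + r * fst u)) (at (x, y))"
    "((\<lambda>p. rho \<kappa> (fst p) (snd p) * snd p) has_derivative (\<lambda>u. D u * y + r * snd u)) (at (x, y))"
    by (auto intro!: derivative_eq_intros D simp: r_def)
  have d: "dir_deriv (stereo \<kappa> s) (x, y) u =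
      (D u * x + r * fst u, D u * y + r * snd u, - (s / sqrt \<kappa>) * D u)" for u
    unfolding st by (rule dir_deriv_eq, intro has_derivative_Pair fs third)
  have ss: "(s / sqrt \<kappa>) * (s / sqrt \<kappa>) = 1 / \<kappa>" using k s by (auto simp: field_simps)
  have "induced_metric (stereo \<kappa> s) (x, y) (u1, u2) (v1, v2) =
     r\<^sup>2 * (u1 * v1 + u2 * v2) + r * (D (u1, u2) * (x * v1 + y * v2) + D (v1, v2) * (x * u1 + y * u2))
     + D (u1, u2) * D (v1, v2) * (x\<^sup>2 + y\<^sup>2) + (s / sqrt \<kappa>) * (s / sqrt \<kappa>) * (D (u1, u2) * D (v1, v2))"
    unfolding induced_metric_def d
    by (simp add: power2_eq_square algebra_simps)
  also have "\<dots> = r\<^sup>2 * (u1 * v1 + u2 * v2)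
     + \<kappa> * r ^ 3 * (x * u1 + y * u2) * (x * v1 + y * v2) * (r * (\<kappa> * (x\<^sup>2 + y\<^sup>2)) + r - 2)"
    unfolding ss D_def using k by (simp add: power2_eq_square power3_eq_cube field_simps)
  finally show ?thesis using rho_eq[OF k, of x y] by (simp add: r_def)
qed

lemma christoffel_eqI:
  assumes "\<And>z. g x w z = koszul g x u v z"
    and "\<And>w'. (\<And>z. g x w' z = g x w z) \<Longrightarrow> w' = w"
  shows "christoffel g x u v = w"
  unfolding christoffel_def using assms by (intro the_equality) auto

lemma Ck_on_const: "Ck_on k (\<lambda>x. c) U"
proof (induction k arbitrary: c)
  case (Suc k)
  have "dir_deriv (\<lambda>x. c) x v = 0" for x v :: 'a by (rule dir_deriv_eq) simp
  with Suc show ?case by simp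
qed simp

definition cylinder_metric :: "real \<Rightarrow> ((real \<times> real) \<times> real) metric" where
  "cylinder_metric \<kappa> p u v = (rho \<kappa> (fst (fst p)) (snd (fst p)))\<^sup>2 * (fst u \<bullet> fst v) + snd u * snd v"

lemma S2_times_R_eq:
  assumes "\<kappa> > 0"
  shows "S2_times_R \<kappa> = {Chart UNIV (map_prod (stereo \<kappa> s) id) (cylinder_metric \<kappa>) |s. s \<in> {1, -1}}"
proof -
  have "(\<lambda>x u v. induced_metric (stereo \<kappa> s) (fst x) (fst u) (fst v) + snd u * snd v)
      = cylinder_metric \<kappa>" if "s \<in> {1, -1}" for s
    by (auto simp: fun_eq_iff cylinder_metric_def induced_metric_stereo[OF assms that])
  then have *: "product_chart (Chart UNIV (stereo \<kappa> s) (induced_metric (stereo \<kappa> s)))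
      (Chart UNIV id (\<lambda>x u v. u * v))
      = Chart UNIV (map_prod (stereo \<kappa> s) id) (cylinder_metric \<kappa>)" if "s \<in> {1, -1}" for s
    using that by (simp only: product_chart.simps UNIV_Times_UNIV)
  have "S2_times_R \<kappa> =
      (\<lambda>s. product_chart (Chart UNIV (stereo \<kappa> s) (induced_metric (stereo \<kappa> s)))
        (Chart UNIV id (\<lambda>x u v. u * v))) ` {1, -1}"
    unfolding S2_times_R_def product_manifold_def round_sphere_def real_line_def by blast
  also have "\<dots> = (\<lambda>s. Chart UNIV (map_prod (stereo \<kappa> s) id) (cylinder_metric \<kappa>)) ` {1, -1}"
    by (rule image_cong[OF refl]) (rule *)
  finally show ?thesis by (simp only: image_def) blast
qed

lemma christoffel_cylinder:
  assumes k: "\<kappa> > 0"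
  shows "christoffel (cylinder_metric \<kappa>) p u v =
    ((\<kappa> * rho \<kappa> (fst (fst p)) (snd (fst p))) *\<^sub>R
       ((fst u \<bullet> fst v) *\<^sub>R fst p - (fst p \<bullet> fst u) *\<^sub>R fst v - (fst p \<bullet> fst v) *\<^sub>R fst u), 0)"
proof (rule christoffel_eqI)
  define r where "r = rho \<kappa> (fst (fst p)) (snd (fst p))"
  have D: "((\<lambda>p. rho \<kappa> (fst (fst p)) (snd (fst p))) has_derivative
      (\<lambda>u. - \<kappa> * r\<^sup>2 * (fst p \<bullet> fst u))) (at p)"
    unfolding r_def
    by (rule has_derivative_eq_rhs[OF rho_has_derivative[OF k]])
       (auto intro!: derivative_eq_intros simp: inner_prod_def)
  have d: "dir_deriv (\<lambda>y. cylinder_metric \<kappa> y v z) p u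
      = - 2 * \<kappa> * r ^ 3 * (fst p \<bullet> fst u) * (fst v \<bullet> fst z)" for u v z
    unfolding cylinder_metric_def
    by (rule dir_deriv_eq)
       (auto intro!: derivative_eq_intros D simp: r_def power2_eq_square power3_eq_cube algebra_simps)
  show "cylinder_metric \<kappa> p ((\<kappa> * rho \<kappa> (fst (fst p)) (snd (fst p))) *\<^sub>R
       ((fst u \<bullet> fst v) *\<^sub>R fst p - (fst p \<bullet> fst u) *\<^sub>R fst v - (fst p \<bullet> fst v) *\<^sub>R fst u), 0) z
      = koszul (cylinder_metric \<kappa>) p u v z" for z
    unfolding koszul_def d
    by (simp add: cylinder_metric_def r_def[symmetric] inner_simps inner_commute
        power2_eq_square power3_eq_cube algebra_simps)
  show "w' = w" if "\<And>z. cylinder_metric \<kappa> p w' z = cylinder_metric \<kappa> p w z" for w w'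
  proof -
    have r: "r \<noteq> 0" using rho_pos(1)[OF k] by (simp add: r_def less_imp_neq[symmetric])
    have "r\<^sup>2 * (fst (w' - w) \<bullet> fst (w' - w)) + snd (w' - w) * snd (w' - w) = 0"
      using that[of "w' - w"] by (simp add: cylinder_metric_def r_def[symmetric] inner_simps algebra_simps)
    then have "fst (w' - w) \<bullet> fst (w' - w) = 0 \<and> snd (w' - w) = 0"
      using r by (smt (verit) inner_ge_zero mult_nonneg_nonneg mult_eq_0_iff zero_le_power2
          zero_le_square power_eq_0_iff)
    then show ?thesis by (simp add: prod_eq_iff)
  qed
qed

lemma ricci_cylinder:
  assumes k: "\<kappa> > 0"
  shows "ricci (cylinder_metric \<kappa>) p v w =
    \<kappa> * (rho \<kappa> (fst (fst p)) (snd (fst p)))\<^sup>2 * (fst v \<bullet> fst w)"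
proof -
  obtain x y t where p: "p = ((x, y), t)" by (metis surj_pair)
  define r where "r = rho \<kappa> x y"
  have D: "((\<lambda>p. rho \<kappa> (fst (fst p)) (snd (fst p))) has_derivative
      (\<lambda>u. - \<kappa> * r\<^sup>2 * (fst p \<bullet> fst u))) (at p)"
    unfolding r_def p
    by (rule has_derivative_eq_rhs[OF rho_has_derivative[OF k]])
       (auto intro!: derivative_eq_intros simp: inner_prod_def)
  have d: "dir_deriv (\<lambda>y. christoffel (cylinder_metric \<kappa>) y v w) p u =
    ((- \<kappa> * \<kappa> * r\<^sup>2 * (fst p \<bullet> fst u)) *\<^sub>R
       ((fst v \<bullet> fst w) *\<^sub>R fst p - (fst p \<bullet> fst v) *\<^sub>R fst w - (fst p \<bullet> fst w) *\<^sub>R fst v)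
     + (\<kappa> * r) *\<^sub>R
       ((fst v \<bullet> fst w) *\<^sub>R fst u - (fst u \<bullet> fst v) *\<^sub>R fst w - (fst u \<bullet> fst w) *\<^sub>R fst v), 0)" for u v w
  proof -
    have A: "((\<lambda>p. \<kappa> * rho \<kappa> (fst (fst p)) (snd (fst p))) has_derivative
        (\<lambda>u. - \<kappa> * \<kappa> * r\<^sup>2 * (fst p \<bullet> fst u))) (at p)"
      by (rule has_derivative_eq_rhs[OF has_derivative_mult_right[OF D]]) (simp add: fun_eq_iff)
    have B: "((\<lambda>p. (fst v \<bullet> fst w) *\<^sub>R fst p - (fst p \<bullet> fst v) *\<^sub>R fst w - (fst p \<bullet> fst w) *\<^sub>R fst v)
        has_derivative
        (\<lambda>u. (fst v \<bullet> fst w) *\<^sub>R fst u - (fst u \<bullet> fst v) *\<^sub>R fst w - (fst u \<bullet> fst w) *\<^sub>R fst v)) (at p)"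
      by (intro has_derivative_diff has_derivative_scaleR_right has_derivative_scaleR_left
          has_derivative_inner_left has_derivative_fst has_derivative_ident)
    show ?thesis
      unfolding christoffel_cylinder[OF k]
      by (rule dir_deriv_eq, rule has_derivative_eq_rhs,
          rule has_derivative_Pair[OF has_derivative_scaleR[OF A B] has_derivative_const])
         (simp add: fun_eq_iff r_def p add.commute)
  qed
  have basis: "(Basis :: ((real \<times> real) \<times> real) set) = {((1, 0), 0), ((0, 1), 0), ((0, 0), 1)}"
    by (auto simp: Basis_prod_def zero_prod_def)
  have e: "r * (\<kappa> * (x\<^sup>2 + y\<^sup>2)) = 2 - r" using rho_eq[OF k] by (simp add: r_def)
  obtain v1 v2 v3 w1 w2 w3 where vw: "v = ((v1, v2), v3)" "w = ((w1, w2), w3)" by (metis surj_pair)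
  have "ricci (cylinder_metric \<kappa>) p v w
      = 2 * \<kappa> * r * (v1 * w1 + v2 * w2) - \<kappa> * r * (r * (\<kappa> * (x\<^sup>2 + y\<^sup>2))) * (v1 * w1 + v2 * w2)"
    unfolding ricci_def basis riemann_def d unfolding christoffel_cylinder[OF k]
    by (simp add: p vw r_def[symmetric]
        power2_eq_square algebra_simps)
  also have "\<dots> = \<kappa> * r\<^sup>2 * (v1 * w1 + v2 * w2)"
    unfolding e by (simp add: power2_eq_square algebra_simps)
  finally show ?thesis by (simp add: vw p r_def)
qed

text \<open>The cylinder over a round sphere is a (shrinking) gradient Ricci soliton: a non-existence
  claim for \<open>S2_times_R \<kappa>\<close> has to exclude \<open>m = \<infinity>\<close> with \<open>\<lambda> = \<kappa>\<close>.\<close>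

theorem shrinking_cylinder:
  assumes k: "\<kappa> > 0"
  shows "quasi_einstein (S2_times_R \<kappa>) \<infinity> \<kappa> (\<lambda>(q, t). \<kappa> * t\<^sup>2 / 2)"
proof -
  define h where "h = (\<lambda>p :: (real \<times> real) \<times> real. \<kappa> * (snd p)\<^sup>2 / 2)"
  have h: "(\<lambda>(q, t). \<kappa> * t\<^sup>2 / 2) \<circ> map_prod (stereo \<kappa> s) id = h" for s
    by (auto simp: h_def fun_eq_iff)
  have h1: "(h has_derivative (\<lambda>v. \<kappa> * snd v * snd p)) (at p)" for p
    unfolding h_def by (auto intro!: derivative_eq_intros)
  have d1: "dir_deriv h p v = \<kappa> * snd v * snd p" for p v
    by (rule dir_deriv_eq) (rule h1)
  have h2: "((\<lambda>p :: (real \<times> real) \<times> real. c * snd p) has_derivative (\<lambda>u. c * snd u)) (at p)" for c p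
    by (auto intro!: derivative_eq_intros)
  have d2: "dir_deriv (\<lambda>p :: (real \<times> real) \<times> real. c * snd p) p u = c * snd u" for c p u
    by (rule dir_deriv_eq) (rule h2)
  have "snd differentiable (at p)" for p :: "(real \<times> real) \<times> real"
    using differentiableI[OF h2[of 1 p]] by simp
  then have "Ck_on k (\<lambda>p :: (real \<times> real) \<times> real. c * snd p) UNIV" for k c
    by (cases k) (auto simp: d2 Ck_on_const intro!: continuous_intros)
  then have "Ck_on k h UNIV" for k
    by (cases k) (auto simp: d1 intro!: continuous_at_imp_continuous_on
        has_derivative_continuous[OF h1] differentiableI[OF h1])
  then have "smooth_on h UNIV" by (simp add: smooth_on_def)
  moreover have "hessian (cylinder_metric \<kappa>) h p u v = \<kappa> * snd u * snd v" for p u v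
    unfolding hessian_def d1 d2 by (simp add: christoffel_cylinder[OF k])
  ultimately show ?thesis
    unfolding quasi_einstein_infinity S2_times_R_eq[OF k]
    by (auto simp: h ricci_cylinder[OF k]) (simp_all add: cylinder_metric_def algebra_simps)
qed

end

theory Submission
  imports Defs
begin

text \<open>Write the equation as \<open>\<nabla>\<^sup>2f = \<mu> df \<otimes> df + A\<close> with \<open>\<mu> = 1/m\<close> and \<open>A = \<lambda> g - Ric\<close>. The Ricci identity
  for \<open>df\<close> gives the first-order integrability condition
  \<open>df(R(u,v)w) = \<mu> (df(u) A(v,w) - df(v) A(u,w)) - (\<nabla>\<^sub>uA(v,w) - \<nabla>\<^sub>vA(u,w))\<close>.

  \<open>Nil\<^sub>3\<close> and the universal cover of \<open>PSl\<^sub>2\<close> are fibrations over a surface of curvature \<open>K \<le> 0\<close> with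
  bundle curvature \<open>T \<noteq> 0\<close> and vertical unit field \<open>\<xi>\<close>. For \<open>u\<close>, \<open>v\<close> horizontal and \<open>w = \<xi>\<close> all terms
  containing \<open>f\<close> vanish, and the condition reduces to \<open>T (K - 4 T\<^sup>2) = 0\<close>, which is impossible.

  On the cylinder the condition gives \<open>\<mu> (\<lambda> - \<kappa>) \<partial>\<^sub>tf = 0\<close> and, for horizontal \<open>u\<close>,
  \<open>(\<kappa> - \<mu> (\<lambda> - \<kappa>)) df(u) = 0\<close>. It follows that \<open>f\<close> depends on \<open>t\<close> only and that \<open>\<lambda> = \<kappa>\<close>; if \<open>\<mu> > 0\<close>, then
  \<open>v = \<partial>\<^sub>tf\<close> solves the Riccati equation \<open>v' = \<mu> v\<^sup>2 + \<kappa>\<close> on the whole line, whereas its solutions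
  blow up in finite time.\<close>

section \<open>Directional derivatives and the symmetry of second derivatives\<close>

lemma has_derivative_dir_deriv:
  "h differentiable (at x) \<Longrightarrow> (h has_derivative dir_deriv h x) (at x)"
  unfolding dir_deriv_def[abs_def] using frechet_derivative_works by blast

lemma linear_dir_deriv: "h differentiable (at x) \<Longrightarrow> linear (dir_deriv h x)"
  using has_derivative_dir_deriv has_derivative_linear by blast

lemma DERIV_along_line:
  fixes h :: "'a::euclidean_space \<Rightarrow> real"
  assumes "h differentiable (at (p + t *\<^sub>R u))"
  shows "((\<lambda>t. h (p + t *\<^sub>R u)) has_real_derivative dir_deriv h (p + t *\<^sub>R u) u) (at t)"
proof -
  have "((\<lambda>t. p + t *\<^sub>R u) has_derivative (\<lambda>t. t *\<^sub>R u)) (at t)"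
    by (auto intro!: derivative_eq_intros)
  from has_derivative_compose[OF this has_derivative_dir_deriv[OF assms]]
  show ?thesis
    by (simp add: has_field_derivative_def linear_cmul[OF linear_dir_deriv[OF assms]]
        mult.commute[of _ "dir_deriv h (p + t *\<^sub>R u) u"])
qed

text \<open>The mean value theorem is applied twice: along \<open>u\<close> to the increment of
  \<open>h\<close> under the shift by \<open>s *\<^sub>R v\<close>, then along \<open>v\<close> to
  the \<open>u\<close>-derivative of \<open>h\<close>.\<close>

lemma second_difference_eq:
  fixes h :: "'a::euclidean_space \<Rightarrow> real"
  assumes s: "s > 0"
    and d1: "\<And>a b. 0 \<le> a \<Longrightarrow> a \<le> s \<Longrightarrow> 0 \<le> b \<Longrightarrow> b \<le> s \<Longrightarrow>
      h differentiable (at (p + a *\<^sub>R u + b *\<^sub>R v))"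
    and d2: "\<And>a b. 0 \<le> a \<Longrightarrow> a \<le> s \<Longrightarrow> 0 \<le> b \<Longrightarrow> b \<le> s \<Longrightarrow>
      (\<lambda>y. dir_deriv h y u) differentiable (at (p + a *\<^sub>R u + b *\<^sub>R v))"
  obtains a b where "0 < a" "a < s" "0 < b" "b < s"
    "h (p + s *\<^sub>R u + s *\<^sub>R v) - h (p + s *\<^sub>R u) - h (p + s *\<^sub>R v) + h p
     = s\<^sup>2 * dir_deriv (\<lambda>y. dir_deriv h y u) (p + a *\<^sub>R u + b *\<^sub>R v) v"
proof -
  define g where "g a = h ((p + s *\<^sub>R v) + a *\<^sub>R u) - h (p + a *\<^sub>R u)" for a
  have "(g has_real_derivative
      dir_deriv h ((p + s *\<^sub>R v) + a *\<^sub>R u) u - dir_deriv h (p + a *\<^sub>R u) u) (at a)"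
    if "0 \<le> a" "a \<le> s" for a
    unfolding g_def
    using that s d1[of a s] d1[of a 0]
    by (intro DERIV_diff DERIV_along_line) (auto simp: algebra_simps)
  from MVT2[OF s this] obtain a where a: "0 < a" "a < s"
    and ga: "g s - g 0 = s * (dir_deriv h ((p + s *\<^sub>R v) + a *\<^sub>R u) u - dir_deriv h (p + a *\<^sub>R u) u)"
    by auto
  define k where "k b = dir_deriv h ((p + a *\<^sub>R u) + b *\<^sub>R v) u" for b
  have "(k has_real_derivative
      dir_deriv (\<lambda>y. dir_deriv h y u) ((p + a *\<^sub>R u) + b *\<^sub>R v) v) (at b)"
    if "0 \<le> b" "b \<le> s" for b
    unfolding k_def using that a d2[of a b] by (intro DERIV_along_line) auto
  from MVT2[OF s this] obtain b where b: "0 < b" "b < s"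
    and kb: "k s - k 0 = s * dir_deriv (\<lambda>y. dir_deriv h y u) (p + a *\<^sub>R u + b *\<^sub>R v) v"
    by auto
  have "h (p + s *\<^sub>R u + s *\<^sub>R v) - h (p + s *\<^sub>R u) - h (p + s *\<^sub>R v) + h p = g s - g 0"
    by (simp add: g_def algebra_simps)
  also have "\<dots> = s * (k s - k 0)"
    unfolding ga by (simp add: k_def algebra_simps)
  finally show ?thesis
    using a b that unfolding kb by (simp add: power2_eq_square)
qed

text \<open>Schwarz's theorem: the second difference is symmetric in \<open>u\<close> and
  \<open>v\<close>, so the two mixed derivatives share a value at points arbitrarily near
  \<open>p\<close>, and continuity excludes different values at \<open>p\<close>.\<close>

lemma dir_deriv_commute:
  fixes h :: "'a::euclidean_space \<Rightarrow> real"
  assumes U: "open U" "p \<in> U" and h: "Ck_on 2 h U"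
  shows "dir_deriv (\<lambda>y. dir_deriv h y u) p v = dir_deriv (\<lambda>y. dir_deriv h y v) p u"
proof (rule ccontr)
  define A where "A y = dir_deriv (\<lambda>y. dir_deriv h y u) y v" for y
  define B where "B y = dir_deriv (\<lambda>y. dir_deriv h y v) y u" for y
  assume "\<not> ?thesis"
  then have ne: "A p \<noteq> B p" by (simp add: A_def B_def)
  define e where "e = dist (A p) (B p) / 2"
  have e: "e > 0" using ne by (simp add: e_def)
  have "continuous_on U A" "continuous_on U B"
    and d1: "\<And>y. y \<in> U \<Longrightarrow> h differentiable (at y)"
    and d2: "\<And>y w. y \<in> U \<Longrightarrow> (\<lambda>y. dir_deriv h y w) differentiable (at y)"
    using h by (auto simp: numeral_2_eq_2 A_def[abs_def] B_def[abs_def])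
  then have "isCont A p" "isCont B p"
    using U by (auto simp: continuous_on_eq_continuous_at)
  then obtain d' d'' where d: "d' > 0" "d'' > 0"
    "\<And>y. dist y p < d' \<Longrightarrow> dist (A y) (A p) < e" "\<And>y. dist y p < d'' \<Longrightarrow> dist (B y) (B p) < e"
    using e unfolding continuous_at_eps_delta by metis
  obtain d0 where d0: "d0 > 0" "ball p d0 \<subseteq> U"
    using U open_contains_ball by blast
  define r where "r = min d0 (min d' d'')"
  \<comment> \<open>Keeps the parallelogram spanned by \<open>s *\<^sub>R u\<close> and
    \<open>s *\<^sub>R v\<close> within distance \<open>r\<close> of \<open>p\<close>; the
    \<open>+ 1\<close> makes the denominator positive even for \<open>u = v = 0\<close>.\<close>
  define s where "s = r / (2 * (norm u + norm v + 1))"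
  have r: "r > 0" using d d0 by (simp add: r_def)
  have n: "norm u + norm v + 1 > 0" using norm_ge_zero[of u] norm_ge_zero[of v] by linarith
  have s: "s > 0" using r n by (simp add: s_def)
  have sn: "s * (norm u + norm v) < r"
  proof -
    have "s * (norm u + norm v) < s * (2 * (norm u + norm v + 1))"
      using s n by (intro mult_strict_left_mono) (simp_all add: distrib_left)
    then show ?thesis using n by (simp add: s_def)
  qed
  have near: "dist (p + a *\<^sub>R u + b *\<^sub>R v) p < r" if "0 \<le> a" "a \<le> s" "0 \<le> b" "b \<le> s" for a b
  proof -
    have "norm (a *\<^sub>R u + b *\<^sub>R v) \<le> a * norm u + b * norm v"
      using norm_triangle_ineq[of "a *\<^sub>R u" "b *\<^sub>R v"] that by simp
    also have "\<dots> \<le> s * norm u + s * norm v"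
      using that by (intro add_mono mult_right_mono) auto
    finally show ?thesis using sn by (simp add: dist_norm algebra_simps)
  qed
  have inU: "p + a *\<^sub>R u + b *\<^sub>R v \<in> U" if "0 \<le> a" "a \<le> s" "0 \<le> b" "b \<le> s" for a b
    using near[OF that] d0 by (auto simp: r_def dist_commute)
  have inU': "p + a *\<^sub>R v + b *\<^sub>R u \<in> U" if "0 \<le> a" "a \<le> s" "0 \<le> b" "b \<le> s" for a b
    using inU[of b a] that by (simp add: add.assoc add.commute add.left_commute)
  obtain a b where ab: "0 < a" "a < s" "0 < b" "b < s"
    "h (p + s *\<^sub>R u + s *\<^sub>R v) - h (p + s *\<^sub>R u) - h (p + s *\<^sub>R v) + h p
     = s\<^sup>2 * A (p + a *\<^sub>R u + b *\<^sub>R v)"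
    using second_difference_eq[OF s d1[OF inU] d2[OF inU]] unfolding A_def by blast
  obtain a' b' where ab': "0 < a'" "a' < s" "0 < b'" "b' < s"
    "h (p + s *\<^sub>R v + s *\<^sub>R u) - h (p + s *\<^sub>R v) - h (p + s *\<^sub>R u) + h p
     = s\<^sup>2 * B (p + a' *\<^sub>R v + b' *\<^sub>R u)"
    using second_difference_eq[OF s d1[OF inU'] d2[OF inU']] unfolding B_def by blast
  have "s\<^sup>2 * A (p + a *\<^sub>R u + b *\<^sub>R v) = s\<^sup>2 * B (p + b' *\<^sub>R u + a' *\<^sub>R v)"
    using ab(5) ab'(5) by (simp add: algebra_simps)
  then have eq: "A (p + a *\<^sub>R u + b *\<^sub>R v) = B (p + b' *\<^sub>R u + a' *\<^sub>R v)"
    using s by simp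
  have "dist (A (p + a *\<^sub>R u + b *\<^sub>R v)) (A p) < e" "dist (B (p + b' *\<^sub>R u + a' *\<^sub>R v)) (B p) < e"
    using near[of a b] near[of b' a'] ab ab' d(3,4) by (auto simp: r_def)
  then show False
    using eq by (simp add: e_def dist_real_def abs_if split: if_splits)
qed

section \<open>The Ricci identity as an integrability condition\<close>

lemma linear_eq_sum_Basis:
  fixes l :: "'a::euclidean_space \<Rightarrow> real"
  assumes "linear l"
  shows "l c = (\<Sum>b\<in>Basis. (c \<bullet> b) * l b)"
proof -
  have "l c = l (\<Sum>b\<in>Basis. (c \<bullet> b) *\<^sub>R b)" by (simp only: euclidean_representation)
  also have "\<dots> = (\<Sum>b\<in>Basis. (c \<bullet> b) * l b)"
    by (simp only: linear_sum[OF assms] linear_cmul[OF assms] real_scaleR_def)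
  finally show ?thesis .
qed

text \<open>Product rule for df(X). As \<open>Ck_on\<close> speaks of derivatives in fixed
  directions, df(X) is expanded in the basis into a finite sum of products of real
  functions.\<close>

lemma has_derivative_dir_deriv_field:
  fixes f :: "'a::euclidean_space \<Rightarrow> real" and X :: "'a \<Rightarrow> 'a"
  assumes U: "open U" "p \<in> U" and f: "Ck_on 2 f U" and X: "X differentiable (at p)"
  shows "((\<lambda>x. dir_deriv f x (X x)) has_derivative
    (\<lambda>u. dir_deriv (\<lambda>y. dir_deriv f y (X p)) p u + dir_deriv f p (dir_deriv X p u))) (at p)"
proof -
  have d1: "f differentiable (at y)" if "y \<in> U" for y
    using f that by (simp add: numeral_2_eq_2)
  have d2: "(\<lambda>y. dir_deriv f y w) differentiable (at p)" for w
    using f U by (simp add: numeral_2_eq_2)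
  note D2 = has_derivative_dir_deriv[OF d2]
  have exp: "dir_deriv f x c = (\<Sum>b\<in>Basis. (c \<bullet> b) * dir_deriv f x b)" if "x \<in> U" for x c
    by (rule linear_eq_sum_Basis[OF linear_dir_deriv[OF d1[OF that]]])
  have const: "dir_deriv (\<lambda>y. dir_deriv f y c) p u
      = (\<Sum>b\<in>Basis. (c \<bullet> b) * dir_deriv (\<lambda>y. dir_deriv f y b) p u)" for c u
  proof (rule dir_deriv_eq)
    have "((\<lambda>y. \<Sum>b\<in>Basis. (c \<bullet> b) * dir_deriv f y b) has_derivative
        (\<lambda>u. \<Sum>b\<in>Basis. (c \<bullet> b) * dir_deriv (\<lambda>y. dir_deriv f y b) p u)) (at p)"
      by (intro has_derivative_sum has_derivative_mult_right D2)
    then show "((\<lambda>y. dir_deriv f y c) has_derivative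
        (\<lambda>u. \<Sum>b\<in>Basis. (c \<bullet> b) * dir_deriv (\<lambda>y. dir_deriv f y b) p u)) (at p)"
      by (rule has_derivative_transform_within_open[OF _ U]) (rule exp[symmetric])
  qed
  have "((\<lambda>x. \<Sum>b\<in>Basis. (X x \<bullet> b) * dir_deriv f x b) has_derivative
      (\<lambda>u. \<Sum>b\<in>Basis. (X p \<bullet> b) * dir_deriv (\<lambda>y. dir_deriv f y b) p u
        + (dir_deriv X p u \<bullet> b) * dir_deriv f p b)) (at p)"
    by (intro has_derivative_sum has_derivative_mult has_derivative_inner_left D2
        has_derivative_dir_deriv[OF X])
  then have "((\<lambda>x. \<Sum>b\<in>Basis. (X x \<bullet> b) * dir_deriv f x b) has_derivative
      (\<lambda>u. dir_deriv (\<lambda>y. dir_deriv f y (X p)) p u + dir_deriv f p (dir_deriv X p u))) (at p)"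
    by (simp only: const[of "X p"] exp[OF U(2), of "dir_deriv X p _"] sum.distrib)
  then show ?thesis
    by (rule has_derivative_transform_within_open[OF _ U]) (rule exp[symmetric])
qed

text \<open>Commute the third derivatives of \<open>f\<close>, eliminating all second derivatives by means of the
  equation; the terms of order \<open>\<mu>\<^sup>2\<close> cancel. The bracket is the skew-symmetrised covariant
  derivative of \<open>A\<close>, since the connection is torsion-free.\<close>

lemma integrability_condition:
  fixes f :: "'a::euclidean_space \<Rightarrow> real"
  assumes U: "open U" "p \<in> U" and f: "Ck_on 3 f U"
    and pde: "\<And>x a b. x \<in> U \<Longrightarrow>
      hessian g f x a b = \<mu> * (dir_deriv f x a * dir_deriv f x b) + A x a b"
    and G: "(\<lambda>x. christoffel g x u w) differentiable (at p)"
      "(\<lambda>x. christoffel g x v w) differentiable (at p)"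
    and A: "(\<lambda>x. A x u w) differentiable (at p)" "(\<lambda>x. A x v w) differentiable (at p)"
  shows "dir_deriv f p (riemann g p u v w) =
    \<mu> * (dir_deriv f p u * A p v w - dir_deriv f p v * A p u w)
    - (dir_deriv (\<lambda>x. A x v w) p u - dir_deriv (\<lambda>x. A x u w) p v
       + A p u (christoffel g p v w) - A p v (christoffel g p u w))"
proof -
  have f2: "Ck_on 2 (\<lambda>x. dir_deriv f x a) U" for a
    using f by (simp add: numeral_2_eq_2 numeral_3_eq_3)
  have d1: "f differentiable (at y)" if "y \<in> U" for y
    using f that by (simp add: numeral_3_eq_3)
  \<comment> \<open>\<open>Ck_on 3\<close> does not literally contain \<open>Ck_on 2\<close>;
    continuity of the second derivatives is recovered from their differentiability.\<close>
  have c2: "continuous_on U (\<lambda>x. dir_deriv (\<lambda>y. dir_deriv f y a) x b)" for a b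
  proof -
    have "(\<lambda>x. dir_deriv (\<lambda>y. dir_deriv f y a) x b) differentiable (at x)" if "x \<in> U" for x
      using f that by (simp add: numeral_3_eq_3)
    then show ?thesis
      by (intro continuous_at_imp_continuous_on ballI differentiable_imp_continuous_within)
  qed
  have d2: "(\<lambda>y. dir_deriv f y a) differentiable (at y)" if "y \<in> U" for a y
    using f that by (simp add: numeral_3_eq_3)
  have f20: "Ck_on 2 f U" using d1 d2 c2 by (simp add: numeral_2_eq_2)
  have snd: "dir_deriv (\<lambda>y. dir_deriv f y b) x a = dir_deriv f x (christoffel g x a b)
      + \<mu> * (dir_deriv f x a * dir_deriv f x b) + A x a b" if "x \<in> U" for x a b
    using pde[OF that, of a b] by (simp add: hessian_def)
  have third: "dir_deriv (\<lambda>x. dir_deriv (\<lambda>y. dir_deriv f y c) x b) p a =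
      dir_deriv f p (christoffel g p a (christoffel g p b c))
      + \<mu> * (dir_deriv f p a * dir_deriv f p (christoffel g p b c))
      + A p a (christoffel g p b c)
      + dir_deriv f p (dir_deriv (\<lambda>x. christoffel g x b c) p a)
      + \<mu> * (dir_deriv f p b * dir_deriv (\<lambda>y. dir_deriv f y c) p a
        + dir_deriv (\<lambda>y. dir_deriv f y b) p a * dir_deriv f p c)
      + dir_deriv (\<lambda>x. A x b c) p a"
    if G': "(\<lambda>x. christoffel g x b c) differentiable (at p)"
      and A': "(\<lambda>x. A x b c) differentiable (at p)" for a b c
  proof (rule dir_deriv_eq)
    have "((\<lambda>x. dir_deriv f x (christoffel g x b c)
        + \<mu> * (dir_deriv f x b * dir_deriv f x c) + A x b c) has_derivative
      (\<lambda>a. dir_deriv (\<lambda>y. dir_deriv f y (christoffel g p b c)) p a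
        + dir_deriv f p (dir_deriv (\<lambda>x. christoffel g x b c) p a)
        + \<mu> * (dir_deriv f p b * dir_deriv (\<lambda>y. dir_deriv f y c) p a
          + dir_deriv (\<lambda>y. dir_deriv f y b) p a * dir_deriv f p c)
        + dir_deriv (\<lambda>x. A x b c) p a)) (at p)"
      by (intro has_derivative_add has_derivative_mult_right has_derivative_mult
          has_derivative_dir_deriv_field[OF U f20 G'] has_derivative_dir_deriv d2 U A')
    from has_derivative_transform_within_open[OF this U snd[symmetric]]
    show "((\<lambda>x. dir_deriv (\<lambda>y. dir_deriv f y c) x b) has_derivative
      (\<lambda>a. dir_deriv f p (christoffel g p a (christoffel g p b c))
      + \<mu> * (dir_deriv f p a * dir_deriv f p (christoffel g p b c))
      + A p a (christoffel g p b c)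
      + dir_deriv f p (dir_deriv (\<lambda>x. christoffel g x b c) p a)
      + \<mu> * (dir_deriv f p b * dir_deriv (\<lambda>y. dir_deriv f y c) p a
        + dir_deriv (\<lambda>y. dir_deriv f y b) p a * dir_deriv f p c)
      + dir_deriv (\<lambda>x. A x b c) p a)) (at p)"
      by (simp only: snd[OF U(2), of "christoffel g p b c"])
  qed
  have "dir_deriv f p (riemann g p u v w) =
      dir_deriv f p (dir_deriv (\<lambda>x. christoffel g x v w) p u)
      - dir_deriv f p (dir_deriv (\<lambda>x. christoffel g x u w) p v)
      + dir_deriv f p (christoffel g p u (christoffel g p v w))
      - dir_deriv f p (christoffel g p v (christoffel g p u w))"
    unfolding riemann_def
    by (simp only: linear_add[OF linear_dir_deriv[OF d1[OF U(2)]]]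
        linear_diff[OF linear_dir_deriv[OF d1[OF U(2)]]])
  \<comment> \<open>Symmetry for df(w) equates the third derivatives; symmetry for \<open>f\<close>
    cancels the \<mu>-terms with the mixed derivative in \<open>u\<close> and \<open>v\<close>. The
    other second derivatives are eliminated by \<open>snd\<close>.\<close>
  then show ?thesis
    using dir_deriv_commute[OF U f2[of w], of v u] dir_deriv_commute[OF U f20, of u v]
      third[OF G(2) A(2), of u] third[OF G(1) A(1), of v]
      snd[OF U(2), of w u] snd[OF U(2), of w v] snd[OF U(2), of u w] snd[OF U(2), of v w]
    by (simp add: algebra_simps)
qed

text \<open>For a = sqrt(\<mu>/k) the function arctan(a v) has constant derivative a k, hence grows
  by \<pi> over an interval of length \<pi>/(a k), while arctan takes values in an open interval of
  length \<pi>.\<close>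

lemma riccati_no_global_solution:
  fixes v :: "real \<Rightarrow> real"
  assumes pos: "\<mu> > 0" "k > 0"
    and v: "\<And>t. (v has_real_derivative \<mu> * (v t)\<^sup>2 + k) (at t)"
  shows False
proof -
  define a where "a = sqrt (\<mu> / k)"
  have a: "a > 0" "a\<^sup>2 = \<mu> / k" using pos by (simp_all add: a_def)
  have "((\<lambda>t. arctan (a * v t)) has_real_derivative a * k) (at t)" for t
  proof (rule DERIV_cong)
    show "((\<lambda>t. arctan (a * v t)) has_real_derivative
        inverse (1 + (a * v t)\<^sup>2) * (a * (\<mu> * (v t)\<^sup>2 + k))) (at t)"
      by (intro DERIV_chain2[OF DERIV_arctan] DERIV_cmult v)
    have "\<mu> * (v t)\<^sup>2 + k = k * (1 + (a * v t)\<^sup>2)"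
      using pos by (simp add: power_mult_distrib a(2) field_simps)
    moreover have "1 + (a * v t)\<^sup>2 \<noteq> 0"
      by (metis add_pos_nonneg less_irrefl zero_le_power2 zero_less_one)
    ultimately show "inverse (1 + (a * v t)\<^sup>2) * (a * (\<mu> * (v t)\<^sup>2 + k)) = a * k"
      by simp
  qed
  moreover have "0 < pi / (a * k)" using a pos by simp
  ultimately have "arctan (a * v (pi / (a * k))) - arctan (a * v 0) = (pi / (a * k) - 0) * (a * k)"
    using MVT2[of 0 "pi / (a * k)" "\<lambda>t. arctan (a * v t)" "\<lambda>_. a * k"] by metis
  then have "arctan (a * v (pi / (a * k))) - arctan (a * v 0) = pi"
    using a pos by simp
  then show False
    using arctan_ubound[of "a * v (pi / (a * k))"] arctan_lbound[of "a * v 0"] by linarith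
qed

section \<open>The round cylinder\<close>

lemma rho_has_derivative_cylinder:
  assumes "\<kappa> > 0"
  shows "((\<lambda>p :: (real \<times> real) \<times> real. rho \<kappa> (fst (fst p)) (snd (fst p))) has_derivative
    (\<lambda>u. - \<kappa> * (rho \<kappa> (fst (fst p)) (snd (fst p)))\<^sup>2 * (fst p \<bullet> fst u))) (at p)"
  by (rule has_derivative_eq_rhs[OF rho_has_derivative[OF assms]])
     (auto intro!: derivative_eq_intros simp: inner_prod_def)

lemma christoffel_cylinder_has_derivative:
  assumes k: "\<kappa> > 0"
  defines "r \<equiv> \<lambda>p :: (real \<times> real) \<times> real. rho \<kappa> (fst (fst p)) (snd (fst p))"
  shows "((\<lambda>y. christoffel (cylinder_metric \<kappa>) y v w) has_derivative
    (\<lambda>u. ((- \<kappa> * \<kappa> * (r p)\<^sup>2 * (fst p \<bullet> fst u)) *\<^sub>R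
       ((fst v \<bullet> fst w) *\<^sub>R fst p - (fst p \<bullet> fst v) *\<^sub>R fst w - (fst p \<bullet> fst w) *\<^sub>R fst v)
     + (\<kappa> * r p) *\<^sub>R
       ((fst v \<bullet> fst w) *\<^sub>R fst u - (fst u \<bullet> fst v) *\<^sub>R fst w - (fst u \<bullet> fst w) *\<^sub>R fst v), 0))) (at p)"
proof -
  have A: "((\<lambda>p. \<kappa> * rho \<kappa> (fst (fst p)) (snd (fst p))) has_derivative
      (\<lambda>u. - \<kappa> * \<kappa> * (r p)\<^sup>2 * (fst p \<bullet> fst u))) (at p)"
    by (rule has_derivative_eq_rhs[OF has_derivative_mult_right[OF rho_has_derivative_cylinder[OF k]]])
       (simp add: fun_eq_iff r_def)
  have B: "((\<lambda>p. (fst v \<bullet> fst w) *\<^sub>R fst p - (fst p \<bullet> fst v) *\<^sub>R fst w - (fst p \<bullet> fst w) *\<^sub>R fst v)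
      has_derivative
      (\<lambda>u. (fst v \<bullet> fst w) *\<^sub>R fst u - (fst u \<bullet> fst v) *\<^sub>R fst w - (fst u \<bullet> fst w) *\<^sub>R fst v)) (at p)"
    by (intro has_derivative_diff has_derivative_scaleR_right has_derivative_scaleR_left
        has_derivative_inner_left has_derivative_fst has_derivative_ident)
  show ?thesis
    unfolding christoffel_cylinder[OF k]
    by (rule has_derivative_eq_rhs,
        rule has_derivative_Pair[OF has_derivative_scaleR[OF A B] has_derivative_const])
       (simp add: fun_eq_iff r_def add.commute)
qed

text \<open>The curvature of a surface of constant curvature \<kappa> with metric
  \<open>rho\<^sup>2\<close> times the flat one, extended by zero in the line direction. The terms
  quadratic in the position collapse by \<open>rho_eq\<close>.\<close>

lemma riemann_cylinder:
  assumes k: "\<kappa> > 0"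
  shows "riemann (cylinder_metric \<kappa>) p u v w =
    ((\<kappa> * (rho \<kappa> (fst (fst p)) (snd (fst p)))\<^sup>2) *\<^sub>R
      ((fst v \<bullet> fst w) *\<^sub>R fst u - (fst u \<bullet> fst w) *\<^sub>R fst v), 0)"
proof -
  obtain x y t where p: "p = ((x, y), t)" by (metis surj_pair)
  obtain u1 u2 u3 v1 v2 v3 w1 w2 w3 where
    uvw: "u = ((u1, u2), u3)" "v = ((v1, v2), v3)" "w = ((w1, w2), w3)" by (metis surj_pair)
  define r where "r = rho \<kappa> x y"
  have e: "r * (\<kappa> * (x * x + y * y)) = 2 - r"
    using rho_eq[OF k] by (simp add: r_def power2_eq_square)
  note d = dir_deriv_eq[OF christoffel_cylinder_has_derivative[OF k]]
  show ?thesis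
    unfolding riemann_def d unfolding christoffel_cylinder[OF k] p uvw
    by (simp add: r_def[symmetric] power2_eq_square) (intro conjI; use e in algebra)
qed

text \<open>The excluded pair is the soliton of \<open>shrinking_cylinder\<close>. One chart
  suffices, because it contains entire vertical lines, on which the Riccati equation then holds for
  all times.\<close>

lemma not_quasi_einstein_cylinder:
  fixes h :: "(real \<times> real) \<times> real \<Rightarrow> real"
  assumes k: "\<kappa> > 0" and mu: "\<mu> \<ge> 0" "(\<mu>, l) \<noteq> (0, \<kappa>)" and h: "Ck_on 3 h UNIV"
    and pde: "\<And>x u v. ricci (cylinder_metric \<kappa>) x u v + hessian (cylinder_metric \<kappa>) h x u v
      - \<mu> * (dir_deriv h x u * dir_deriv h x v) = l * cylinder_metric \<kappa> x u v"
  shows False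
proof -
  define r where "r p = rho \<kappa> (fst (fst p)) (snd (fst p))" for p :: "(real \<times> real) \<times> real"
  define A where "A p u v = (l - \<kappa>) * (fst u \<bullet> fst v) * (r p)\<^sup>2 + l * snd u * snd v"
    for p u v :: "(real \<times> real) \<times> real"
  define e1 e2 e3 :: "(real \<times> real) \<times> real" where e: "e1 = ((1, 0), 0)" "e2 = ((0, 1), 0)" "e3 = ((0, 0), 1)"
  have r0: "r p \<noteq> 0" for p using rho_pos(1)[OF k] by (simp add: r_def less_imp_neq[symmetric])
  have hess: "hessian (cylinder_metric \<kappa>) h x u v
      = \<mu> * (dir_deriv h x u * dir_deriv h x v) + A x u v" for x u v
    using pde[of x u v]
    by (simp add: A_def ricci_cylinder[OF k] cylinder_metric_def r_def algebra_simps)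
  have dA: "((\<lambda>p. A p u v) has_derivative
      (\<lambda>w. - 2 * \<kappa> * (l - \<kappa>) * (fst u \<bullet> fst v) * (r p) ^ 3 * (fst p \<bullet> fst w))) (at p)" for u v p
    unfolding A_def r_def
    by (auto intro!: derivative_eq_intros rho_has_derivative_cylinder[OF k]
        simp: power2_eq_square power3_eq_cube algebra_simps)
  have d1: "h differentiable (at p)" and d2: "(\<lambda>y. dir_deriv h y u) differentiable (at p)" for p u
    using h by (simp_all add: numeral_3_eq_3 del: split_paired_All)
  have lin: "dir_deriv h p (c *\<^sub>R u) = c * dir_deriv h p u" for p c u
    using linear_cmul[OF linear_dir_deriv[OF d1]] by simp
  have h0: "dir_deriv h p 0 = 0" for p
    using linear_0[OF linear_dir_deriv[OF d1]] .
  have int: "dir_deriv h p (riemann (cylinder_metric \<kappa>) p u v w) =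
    \<mu> * (dir_deriv h p u * A p v w - dir_deriv h p v * A p u w)
    - (dir_deriv (\<lambda>x. A x v w) p u - dir_deriv (\<lambda>x. A x u w) p v
       + A p u (christoffel (cylinder_metric \<kappa>) p v w)
       - A p v (christoffel (cylinder_metric \<kappa>) p u w))" for p u v w
    by (rule integrability_condition[OF open_UNIV UNIV_I h hess])
       (rule differentiableI[OF christoffel_cylinder_has_derivative[OF k]] differentiableI[OF dA])+
  \<comment> \<open>The line direction is flat, so the curvature term vanishes; the bracket vanishes
    as well, since \<open>A\<close> is parallel.\<close>
  have eq3: "\<mu> * dir_deriv h p e3 * (l - \<kappa>) = 0" for p
  proof -
    have "dir_deriv h p (riemann (cylinder_metric \<kappa>) p e3 e1 e1) = 0"
      by (simp add: riemann_cylinder[OF k] e h0 flip: zero_prod_def)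
    then show ?thesis
      unfolding int dir_deriv_eq[OF dA] christoffel_cylinder[OF k]
      using r0[of p] by (simp add: e A_def inner_prod_def)
  qed
  \<comment> \<open>Here the curvature of the sphere contributes the summand \<kappa>.\<close>
  have eq1: "(\<kappa> - \<mu> * (l - \<kappa>)) * dir_deriv h p e1 = 0" for p
  proof -
    have "riemann (cylinder_metric \<kappa>) p e1 e2 e2 = (\<kappa> * (r p)\<^sup>2) *\<^sub>R e1"
      by (simp add: riemann_cylinder[OF k] e r_def)
    then have "\<kappa> * (r p)\<^sup>2 * dir_deriv h p e1 = dir_deriv h p (riemann (cylinder_metric \<kappa>) p e1 e2 e2)"
      by (simp add: lin)
    also have "\<dots> = \<mu> * (l - \<kappa>) * (r p)\<^sup>2 * dir_deriv h p e1"
      unfolding int dir_deriv_eq[OF dA] christoffel_cylinder[OF k]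
      by (simp add: e A_def r_def[symmetric] inner_prod_def power2_eq_square power3_eq_cube algebra_simps)
    finally have "(r p)\<^sup>2 * ((\<kappa> - \<mu> * (l - \<kappa>)) * dir_deriv h p e1) = 0"
      by (simp add: algebra_simps)
    then show ?thesis using r0[of p] by simp
  qed
  have dz: "dir_deriv (\<lambda>y. 0 :: real) p u = 0" for p u :: "(real \<times> real) \<times> real"
    by (rule dir_deriv_eq) simp
  have hess3: "dir_deriv (\<lambda>y. dir_deriv h y e3) p e3 = \<mu> * (dir_deriv h p e3)\<^sup>2 + l" for p
    using hess[of p e3 e3]
    by (simp add: hessian_def christoffel_cylinder[OF k] e A_def power2_eq_square h0 flip: zero_prod_def)
  \<comment> \<open>Unless the coefficient is \<kappa> itself, \<open>eq3\<close> makes df(e3)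
    vanish; the vertical equation \<open>hess3\<close> then forces l = 0, and the coefficient is
    \<kappa> (1 + \<mu>).\<close>
  have nz: "\<kappa> - \<mu> * (l - \<kappa>) \<noteq> 0"
  proof (cases "\<mu> = 0 \<or> l = \<kappa>")
    case False
    then have z: "dir_deriv h p e3 = 0" for p using eq3[of p] by simp
    have "l = 0" using hess3[of 0] by (simp add: z dz)
    then have "\<kappa> - \<mu> * (l - \<kappa>) = \<kappa> + \<mu> * \<kappa>" by (simp add: algebra_simps)
    moreover have "\<kappa> + \<mu> * \<kappa> > 0" using k mu by (simp add: add_pos_nonneg)
    ultimately show ?thesis by simp
  qed (use k in auto)
  then have z1: "dir_deriv h p e1 = 0" for p using eq1[of p] by simp
  \<comment> \<open>At the origin of the chart the connection term in the Hessian vanishes, so only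
    \<open>A\<close> remains of the equation for \<open>e1\<close>.\<close>
  have "A 0 e1 e1 = 0"
    using hess[of 0 e1 e1] unfolding hessian_def z1 dz
    by (simp add: christoffel_cylinder[OF k] e h0 flip: zero_prod_def)
  then have l: "l = \<kappa>" using r0[of 0] by (simp add: A_def e)
  then have "\<mu> > 0" using mu by auto
  moreover have "((\<lambda>t. dir_deriv h (t *\<^sub>R e3) e3) has_real_derivative
      \<mu> * (dir_deriv h (t *\<^sub>R e3) e3)\<^sup>2 + \<kappa>) (at t)" for t
    using DERIV_along_line[OF d2[of e3 "0 + t *\<^sub>R e3"]] by (simp add: hess3 l)
  ultimately show False using riccati_no_global_solution[OF _ k] by blast
qed

section \<open>Bianchi-Cartan-Vranceanu metrics\<close>

text \<open>These are the fibrations over the surface with metric \<open>r\<^sup>2 (dx\<^sup>2 + dy\<^sup>2)\<close>, where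
  \<open>r = 1 / (d + e (x\<^sup>2 + y\<^sup>2))\<close>, which has curvature \<open>4 d e\<close>. The connection form \<open>\<theta> = bcv_form\<close>
  satisfies \<open>d\<theta> = - 2 s d r\<^sup>2 dx \<and> dy\<close>, so that the bundle curvature is \<open>T = s d\<close>. The first two
  components of \<open>bcv_christoffel\<close> are those of the base plus \<open>T (\<theta>(v) J u + \<theta>(u) J v)\<close> with
  \<open>J(u\<^sub>1, u\<^sub>2) = (u\<^sub>2, - u\<^sub>1)\<close>; the third one is determined by \<open>bcv_form_christoffel\<close> below.\<close>

context
  fixes d e s :: real
begin

definition bcv_rad :: "real \<times> real \<times> real \<Rightarrow> real" where
  "bcv_rad p = 1 / (d + e * ((fst p)\<^sup>2 + (fst (snd p))\<^sup>2))"

definition bcv_form :: "real \<times> real \<times> real \<Rightarrow> real \<times> real \<times> real \<Rightarrow> real" where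
  "bcv_form p u = s * bcv_rad p * (fst (snd p) * fst u - fst p * fst (snd u)) + snd (snd u)"

definition bcv_metric :: "(real \<times> real \<times> real) metric" where
  "bcv_metric p u v = (bcv_rad p)\<^sup>2 * (fst u * fst v + fst (snd u) * fst (snd v))
     + bcv_form p u * bcv_form p v"

definition bcv_dom :: "(real \<times> real \<times> real) set" where
  "bcv_dom = {p. d + e * ((fst p)\<^sup>2 + (fst (snd p))\<^sup>2) > 0}"

definition bcv_christoffel ::
  "real \<times> real \<times> real \<Rightarrow> real \<times> real \<times> real \<Rightarrow> real \<times> real \<times> real \<Rightarrow> real \<times> real \<times> real" where
  "bcv_christoffel p u v =
    (let x = fst p; y = fst (snd p); r = bcv_rad p;
         uv = fst u * fst v + fst (snd u) * fst (snd v);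
         pu = x * fst u + y * fst (snd u); pv = x * fst v + y * fst (snd v);
         a = 2 * e * r * (uv * x - pu * fst v - pv * fst u)
           + s * d * (bcv_form p v * fst (snd u) + bcv_form p u * fst (snd v));
         b = 2 * e * r * (uv * y - pu * fst (snd v) - pv * fst (snd u))
           - s * d * (bcv_form p v * fst u + bcv_form p u * fst v)
     in (a, b, - e * s * r\<^sup>2 * (pu * (y * fst v - x * fst (snd v)) + pv * (y * fst u - x * fst (snd u)))
           - s * r * (y * a - x * b)))"

lemma open_bcv_dom: "open bcv_dom"
proof -
  have "bcv_dom = (\<lambda>p. d + e * ((fst p)\<^sup>2 + (fst (snd p))\<^sup>2)) -` {0<..}"
    by (auto simp: bcv_dom_def)
  then show ?thesis
    by (auto intro!: open_vimage continuous_intros)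
qed

lemma bcv_rad_pos: "p \<in> bcv_dom \<Longrightarrow> bcv_rad p > 0"
  by (simp add: bcv_dom_def bcv_rad_def)

lemma bcv_rad_eq: "p \<in> bcv_dom \<Longrightarrow> bcv_rad p * (d + e * ((fst p)\<^sup>2 + (fst (snd p))\<^sup>2)) = 1"
  by (simp add: bcv_dom_def bcv_rad_def)

lemma bcv_rad_has_derivative:
  assumes "p \<in> bcv_dom"
  shows "(bcv_rad has_derivative
    (\<lambda>w. - 2 * e * (bcv_rad p)\<^sup>2 * (fst p * fst w + fst (snd p) * fst (snd w)))) (at p)"
  using assms unfolding bcv_rad_def bcv_dom_def
  by (auto intro!: derivative_eq_intros simp: power2_eq_square divide_simps algebra_simps)

definition bcv_form_deriv ::
  "real \<times> real \<times> real \<Rightarrow> real \<times> real \<times> real \<Rightarrow> real \<times> real \<times> real \<Rightarrow> real" where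
  "bcv_form_deriv p w u =
     s * (- 2 * e * (bcv_rad p)\<^sup>2 * (fst p * fst w + fst (snd p) * fst (snd w))
         * (fst (snd p) * fst u - fst p * fst (snd u))
       + bcv_rad p * (fst (snd w) * fst u - fst w * fst (snd u)))"

lemma bcv_form_has_derivative:
  assumes "p \<in> bcv_dom"
  shows "((\<lambda>p. bcv_form p u) has_derivative (\<lambda>w. bcv_form_deriv p w u)) (at p)"
  unfolding bcv_form_def bcv_form_deriv_def
  by (auto intro!: derivative_eq_intros bcv_rad_has_derivative[OF assms] simp: algebra_simps)

text \<open>The difference of the two sides is the formula for d\<theta>; \<open>bcv_rad_eq\<close>
  turns 1 - r e (x^2 + y^2) into r d.\<close>

lemma bcv_form_deriv_swap:
  assumes "p \<in> bcv_dom"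
  shows "bcv_form_deriv p w u = bcv_form_deriv p u w
    + 2 * (s * d) * (bcv_rad p)\<^sup>2 * (fst (snd w) * fst u - fst w * fst (snd u))"
proof -
  obtain x y t where p: "p = (x, y, t)" by (metis surj_pair)
  obtain u1 u2 u3 w1 w2 w3 where uw: "u = (u1, u2, u3)" "w = (w1, w2, w3)" by (metis surj_pair)
  define r where "r = bcv_rad p"
  have rr: "r * (d + e * (x\<^sup>2 + y\<^sup>2)) = 1" using bcv_rad_eq[OF assms] by (simp add: p r_def)
  have "bcv_form_deriv p w u - bcv_form_deriv p u w
      = 2 * s * r * (w2 * u1 - w1 * u2) * (1 - r * (e * (x\<^sup>2 + y\<^sup>2)))"
    unfolding bcv_form_deriv_def r_def[symmetric]
    by (simp add: p uw power2_eq_square algebra_simps)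
  also have "1 - r * (e * (x\<^sup>2 + y\<^sup>2)) = r * d" using rr by (simp add: algebra_simps)
  finally show ?thesis by (simp add: uw r_def power2_eq_square algebra_simps)
qed

text \<open>This is the Koszul formula for z = \<xi>: the metric does not depend on t, and \<theta>
  is the inner product with \<xi>.\<close>

lemma bcv_form_christoffel:
  "bcv_form p (bcv_christoffel p u v) = (bcv_form_deriv p u v + bcv_form_deriv p v u) / 2"
proof -
  have "bcv_form p (a, b, c - s * bcv_rad p * (fst (snd p) * a - fst p * b)) = c" for a b c
    by (simp add: bcv_form_def)
  then show ?thesis
    unfolding bcv_christoffel_def Let_def
    by (simp only:) (simp add: bcv_form_deriv_def field_simps)
qed

lemma christoffel_bcv:
  assumes p: "p \<in> bcv_dom"
  shows "christoffel bcv_metric p u v = bcv_christoffel p u v"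
proof (rule christoffel_eqI)
  define r where "r = bcv_rad p"
  have r: "r \<noteq> 0" using bcv_rad_pos[OF p] by (simp add: r_def)
  have D: "dir_deriv (\<lambda>y. bcv_metric y v z) p u =
      - 4 * e * r ^ 3 * (fst p * fst u + fst (snd p) * fst (snd u))
        * (fst v * fst z + fst (snd v) * fst (snd z))
      + bcv_form_deriv p u v * bcv_form p z + bcv_form p v * bcv_form_deriv p u z" for u v z
    unfolding bcv_metric_def
    by (rule dir_deriv_eq)
       (auto intro!: derivative_eq_intros bcv_rad_has_derivative[OF p] bcv_form_has_derivative[OF p]
         simp: r_def power2_eq_square power3_eq_cube algebra_simps)
  \<comment> \<open>Swapping arguments cancels the derivatives of \<theta> along \<open>z\<close>
    and leaves values of d\<theta>, which produce the summands with \<open>s * d\<close>.\<close>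
  show "bcv_metric p (bcv_christoffel p u v) z = koszul bcv_metric p u v z" for z
    unfolding koszul_def D
    unfolding bcv_metric_def bcv_form_christoffel r_def[symmetric]
      bcv_form_deriv_swap[OF p, of u z] bcv_form_deriv_swap[OF p, of v z]
    by (simp add: bcv_christoffel_def Let_def r_def[symmetric]
        power2_eq_square power3_eq_cube field_simps)
  show "w' = w" if eq: "\<And>z. bcv_metric p w' z = bcv_metric p w z" for w w'
  proof -
    define c where "c = w' - w"
    have lin: "bcv_form p c = bcv_form p w' - bcv_form p w"
      by (simp add: bcv_form_def c_def algebra_simps)
    have "bcv_metric p c c = bcv_metric p w' c - bcv_metric p w c"
      unfolding bcv_metric_def lin by (simp add: c_def algebra_simps)
    then have "r\<^sup>2 * ((fst c)\<^sup>2 + (fst (snd c))\<^sup>2) + (bcv_form p c)\<^sup>2 = 0"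
      using eq[of c] by (simp add: bcv_metric_def r_def power2_eq_square)
    then have "r\<^sup>2 * ((fst c)\<^sup>2 + (fst (snd c))\<^sup>2) = 0" and f: "bcv_form p c = 0"
      by (simp_all add: add_nonneg_eq_0_iff)
    then have "fst c = 0" "fst (snd c) = 0" using r by simp_all
    with f have "c = 0" by (simp add: bcv_form_def prod_eq_iff)
    then show ?thesis by (simp add: c_def)
  qed
qed

lemma has_derivative_christoffel_bcv:
  assumes p: "p \<in> bcv_dom" and "((\<lambda>y. bcv_christoffel y v w) has_derivative D) (at p)"
  shows "((\<lambda>y. christoffel bcv_metric y v w) has_derivative D) (at p)"
  by (rule has_derivative_transform_within_open[OF assms(2) open_bcv_dom p])
     (simp add: christoffel_bcv)

end

section \<open>The fibre direction, and the connection to first order at the origin\<close>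

context
  fixes d e s :: real
begin

private abbreviation "G \<equiv> bcv_christoffel d e s"
private abbreviation "r \<equiv> bcv_rad d e"
private abbreviation "\<theta> \<equiv> bcv_form d e s"
private abbreviation "g \<equiv> bcv_metric d e s"

text \<open>The covariant derivative of \<xi> along v is T J v, lifted to a horizontal vector by the
  third component.\<close>

lemma bcv_christoffel_vertical:
  "G p v (0, 0, 1) = (s * d * fst (snd v), - (s * d * fst v),
     - (s * d * s) * (r p * (fst (snd p) * fst (snd v) + fst p * fst v)))"
  by (simp add: bcv_christoffel_def Let_def bcv_form_def algebra_simps)

lemma bcv_christoffel_vertical_has_derivative:
  assumes p: "p \<in> bcv_dom d e"
  shows "((\<lambda>p. G p v (0, 0, 1)) has_derivative
    (\<lambda>w. (0, 0, - (s * d * s) * (r p * (fst (snd w) * fst (snd v) + fst w * fst v)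
      - 2 * e * (r p)\<^sup>2 * (fst p * fst w + fst (snd p) * fst (snd w))
         * (fst (snd p) * fst (snd v) + fst p * fst v))))) (at p)"
  unfolding bcv_christoffel_vertical
  by (intro has_derivative_Pair has_derivative_const)
     (auto intro!: derivative_eq_intros bcv_rad_has_derivative[OF p] simp: algebra_simps)

lemma Basis_real3: "(Basis :: (real \<times> real \<times> real) set) = {(1, 0, 0), (0, 1, 0), (0, 0, 1)}"
  by (auto simp: Basis_prod_def zero_prod_def)

text \<open>Thus \<xi> is a Ricci eigenvector with constant eigenvalue 2 T^2, which makes A(v,
  \<xi>) a constant multiple of \<theta>(v).\<close>

lemma ricci_bcv_vertical:
  assumes p: "p \<in> bcv_dom d e"
  shows "ricci g p v (0, 0, 1) = 2 * (s * d)\<^sup>2 * \<theta> p v"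
proof -
  obtain x y t where xyt: "p = (x, y, t)" by (metis surj_pair)
  obtain v1 v2 v3 where v: "v = (v1, v2, v3)" by (metis surj_pair)
  note d = dir_deriv_eq[OF has_derivative_christoffel_bcv[OF p
        bcv_christoffel_vertical_has_derivative[OF p]]]
  show ?thesis
    unfolding ricci_def Basis_real3 riemann_def d
    unfolding christoffel_bcv[OF p] bcv_christoffel_vertical
    by (simp add: bcv_christoffel_def Let_def bcv_form_def xyt v power2_eq_square algebra_simps)
qed

text \<open>At the origin \<open>r\<close> has derivative zero and \<theta> is the third component,
  so few terms survive.\<close>

lemma bcv_christoffel_has_derivative_0:
  assumes d: "d > 0"
  shows "((\<lambda>p. G p u v) has_derivative
    (\<lambda>(w1, w2, w3). case (u, v) of ((u1, u2, u3), (v1, v2, v3)) \<Rightarrow>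
      (2 * e / d * ((u1 * v1 + u2 * v2) * w1 - (w1 * u1 + w2 * u2) * v1 - (w1 * v1 + w2 * v2) * u1)
         + s\<^sup>2 * ((w2 * v1 - w1 * v2) * u2 + (w2 * u1 - w1 * u2) * v2),
       2 * e / d * ((u1 * v1 + u2 * v2) * w2 - (w1 * u1 + w2 * u2) * v2 - (w1 * v1 + w2 * v2) * u2)
         - s\<^sup>2 * ((w2 * v1 - w1 * v2) * u1 + (w2 * u1 - w1 * u2) * v1),
       - s\<^sup>2 * (w2 * (v3 * u2 + u3 * v2) + w1 * (v3 * u1 + u3 * v1))))) (at 0)"
proof -
  obtain u1 u2 u3 v1 v2 v3 where uv: "u = (u1, u2, u3)" "v = (v1, v2, v3)" by (metis surj_pair)
  have 0: "0 \<in> bcv_dom d e" using d by (simp add: bcv_dom_def)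
  have r0: "r 0 = 1 / d" by (simp add: bcv_rad_def)
  have t0: "\<theta> 0 q = snd (snd q)" for q by (simp add: bcv_form_def)
  have R: "(r has_derivative (\<lambda>w. 0)) (at 0)"
    using bcv_rad_has_derivative[OF 0] by simp
  have TH: "((\<lambda>p. \<theta> p q) has_derivative
      (\<lambda>w. s / d * (fst (snd w) * fst q - fst w * fst (snd q)))) (at 0)" for q
    using bcv_form_has_derivative[OF 0, of s q] by (simp add: bcv_form_deriv_def r0)
  show ?thesis
    unfolding bcv_christoffel_def Let_def
    by (rule has_derivative_eq_rhs, (rule R TH derivative_intros)+)
       (use d in \<open>auto simp: fun_eq_iff r0 t0 uv field_simps power2_eq_square\<close>)
qed

end

section \<open>Curvature at the origin and the contradiction for nonzero bundle curvature\<close>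

context
  fixes d e s :: real
  assumes d: "d > 0"
begin

lemma zero_in_bcv_dom: "0 \<in> bcv_dom d e"
  using d by (simp add: bcv_dom_def)

lemmas christoffel_bcv_0 = christoffel_bcv[OF zero_in_bcv_dom]

lemmas christoffel_bcv_0_has_derivative =
  has_derivative_christoffel_bcv[OF zero_in_bcv_dom bcv_christoffel_has_derivative_0[OF d]]

lemma bcv_christoffel_0:
  "bcv_christoffel d e s 0 (u1, u2, u3) (v1, v2, v3) =
    (s * d * (v3 * u2 + u3 * v2), - (s * d * (v3 * u1 + u3 * v1)), 0)"
  by (simp add: bcv_christoffel_def Let_def bcv_form_def)

text \<open>The metric on these vectors is 1/d^2 at the origin, so the Ricci eigenvalue is K - 2
  T^2. The factor \<open>c\<close> accommodates the multiples of \<open>s * d\<close> in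
  \<open>bcv_christoffel_0\<close>.\<close>

lemma ricci_bcv_horizontal_0:
  "ricci (bcv_metric d e s) 0 (1, 0, 0) (c, 0, 0) = c * (4 * e / d - 2 * s\<^sup>2)"
  "ricci (bcv_metric d e s) 0 (0, 1, 0) (0, c, 0) = c * (4 * e / d - 2 * s\<^sup>2)"
  unfolding ricci_def Basis_real3 riemann_def dir_deriv_eq[OF christoffel_bcv_0_has_derivative]
    christoffel_bcv_0
  by (simp_all add: bcv_christoffel_0 algebra_simps)

text \<open>Removes df from the left-hand side of the integrability condition.\<close>

lemma riemann_bcv_vertical_0:
  "riemann (bcv_metric d e s) 0 (1, 0, 0) (0, 1, 0) (0, 0, 1) = 0"
  unfolding riemann_def dir_deriv_eq[OF christoffel_bcv_0_has_derivative] christoffel_bcv_0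
  by (simp add: bcv_christoffel_0 prod_eq_iff)

text \<open>The condition at the origin becomes 8 s (s^2 d - e) = 0, which is T (K - 4 T^2) = 0 up
  to the factor -2/d^2; it fails because e \<le> 0 < s^2 d.\<close>

lemma not_quasi_einstein_bcv:
  assumes es: "e \<le> 0" "s \<noteq> 0" and f: "Ck_on 3 f (bcv_dom d e)"
    and pde: "\<And>x u v. x \<in> bcv_dom d e \<Longrightarrow>
      ricci (bcv_metric d e s) x u v + hessian (bcv_metric d e s) f x u v
      - \<mu> * (dir_deriv f x u * dir_deriv f x v) = l * bcv_metric d e s x u v"
  shows False
proof -
  define g where "g = bcv_metric d e s"
  define A where "A x u v = l * g x u v - ricci g x u v" for x u v
  define e1 e2 e3 :: "real \<times> real \<times> real" where e: "e1 = (1, 0, 0)" "e2 = (0, 1, 0)" "e3 = (0, 0, 1)"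
  note 0 = zero_in_bcv_dom
  have r0: "bcv_rad d e 0 = 1 / d" by (simp add: bcv_rad_def)
  have A3: "A x v e3 = (l - 2 * (s * d)\<^sup>2) * bcv_form d e s x v" if "x \<in> bcv_dom d e" for x v
    unfolding A_def g_def e ricci_bcv_vertical[OF that]
    by (simp add: bcv_metric_def bcv_form_def[of _ _ _ x "(0, 0, 1)"] algebra_simps)
  have dA: "((\<lambda>x. A x v e3) has_derivative
      (\<lambda>w. (l - 2 * (s * d)\<^sup>2) * bcv_form_deriv d e s 0 w v)) (at 0)" for v
    by (rule has_derivative_transform_within_open[OF _ open_bcv_dom 0 A3[symmetric]])
       (intro has_derivative_mult_right bcv_form_has_derivative 0)
  have hess: "hessian g f x u v = \<mu> * (dir_deriv f x u * dir_deriv f x v) + A x u v"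
    if "x \<in> bcv_dom d e" for x u v
    using pde[OF that, of u v] by (simp add: A_def g_def algebra_simps)
  have f': "f differentiable (at 0)"
    using f 0 by (simp add: numeral_3_eq_3 del: split_paired_All)
  have dG: "(\<lambda>x. christoffel g x u v) differentiable (at 0)" for u v
    unfolding g_def by (rule differentiableI[OF christoffel_bcv_0_has_derivative])
  have int: "dir_deriv f 0 (riemann g 0 e1 e2 e3) =
    \<mu> * (dir_deriv f 0 e1 * A 0 e2 e3 - dir_deriv f 0 e2 * A 0 e1 e3)
    - (dir_deriv (\<lambda>x. A x e2 e3) 0 e1 - dir_deriv (\<lambda>x. A x e1 e3) 0 e2
       + A 0 e1 (christoffel g 0 e2 e3) - A 0 e2 (christoffel g 0 e1 e3))"
    by (rule integrability_condition[OF open_bcv_dom 0 f hess dG dG])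
       (assumption | rule differentiableI[OF dA])+
  have R0: "dir_deriv f 0 (riemann g 0 e1 e2 e3) = 0"
    unfolding e g_def riemann_bcv_vertical_0 by (rule linear_0[OF linear_dir_deriv[OF f']])
  \<comment> \<open>\<open>e1\<close> and \<open>e2\<close> are horizontal at the origin, so the
    \<mu>-term disappears.\<close>
  have A0: "A 0 e2 e3 = 0" "A 0 e1 e3 = 0"
    unfolding A3[OF 0] by (simp_all add: bcv_form_def e)
  \<comment> \<open>The first factor is d\<theta>(e1, e2) at the origin.\<close>
  have X: "dir_deriv (\<lambda>x. A x e2 e3) 0 e1 - dir_deriv (\<lambda>x. A x e1 e3) 0 e2
      = - (2 * s / d) * (l - 2 * (s * d)\<^sup>2)"
    unfolding dir_deriv_eq[OF dA] by (simp add: bcv_form_deriv_def r0 e algebra_simps)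
  \<comment> \<open>The covariant derivatives of \<xi> along \<open>e2\<close> and \<open>e1\<close>
    are s d e1 and - s d e2, so this is s d (A(e1, e1) + A(e2, e2)).\<close>
  have Y: "A 0 e1 (christoffel g 0 e2 e3) - A 0 e2 (christoffel g 0 e1 e3)
      = 2 * s * d * (l / d\<^sup>2 - (4 * e / d - 2 * s\<^sup>2))"
    unfolding g_def christoffel_bcv_0 A_def e bcv_christoffel_0
    by (simp add: ricci_bcv_horizontal_0 ricci_bcv_horizontal_0[where c = "- (s * d)"]
        bcv_metric_def bcv_form_def r0
        power2_eq_square algebra_simps)
  have "- (2 * s / d) * (l - 2 * (s * d)\<^sup>2)
      + 2 * s * d * (l / d\<^sup>2 - (4 * e / d - 2 * s\<^sup>2)) = 0"
    using int unfolding R0 A0 X[symmetric] Y[symmetric] by simp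
  also have "- (2 * s / d) * (l - 2 * (s * d)\<^sup>2)
      + 2 * s * d * (l / d\<^sup>2 - (4 * e / d - 2 * s\<^sup>2)) = 8 * s * (s\<^sup>2 * d - e)"
    using d by (simp add: field_simps power2_eq_square)
  finally have "s * (s\<^sup>2 * d - e) = 0" by simp
  moreover have "s\<^sup>2 * d > 0" using d es by simp
  ultimately show False using es by (simp add: algebra_simps)
qed

end

section \<open>The two fibrations as members of the family, and the conclusion\<close>

lemma nil_metric_eq_bcv: "nil_metric \<tau> = bcv_metric 1 0 (- \<tau>)"
  by (auto simp: fun_eq_iff nil_metric_def bcv_metric_def bcv_form_def bcv_rad_def algebra_simps)

text \<open>With these parameters K = \<kappa> and T = \<kappa> \<tau>.\<close>

lemma psl2_metric_eq_bcv: "psl2_metric \<kappa> \<tau> = bcv_metric (1 / 2) (\<kappa> / 2) (2 * \<kappa> * \<tau>)"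
proof -
  have "rho \<kappa> x y = 1 / (1 / 2 + \<kappa> / 2 * (x\<^sup>2 + y\<^sup>2))" for x y
    by (simp add: rho_def field_simps flip: add_divide_distrib)
  then show ?thesis
    by (auto simp: fun_eq_iff psl2_metric_def bcv_metric_def bcv_form_def bcv_rad_def)
qed

lemma bcv_dom_nil: "bcv_dom 1 0 = UNIV"
  by (simp add: bcv_dom_def)

lemma bcv_dom_psl2: "bcv_dom (1 / 2) (\<kappa> / 2) = {(x, y, t). 1 + \<kappa> * (x\<^sup>2 + y\<^sup>2) > 0}"
  by (auto simp: bcv_dom_def field_simps)

lemma real_of_ereal_inverse_nonneg:
  assumes "0 < (m :: ereal)"
  shows "real_of_ereal (1 / m) \<ge> 0" "real_of_ereal (1 / m) = 0 \<longleftrightarrow> m = \<infinity>"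
  using assms by (cases m; simp add: one_ereal_def)+

text \<open>The pair (\<infinity>, \<kappa>) is left out for the cylinder because
  \<open>shrinking_cylinder\<close> realises it.\<close>

theorem corollary1:
  fixes \<kappa> \<tau> :: real
  shows "(\<kappa> > 0 \<longrightarrow>
            \<not> (\<exists>f m l. 0 < m \<and> m \<le> \<infinity> \<and> (m, l) \<noteq> (\<infinity>, \<kappa>) \<and>
               quasi_einstein (S2_times_R \<kappa>) m l f))
       \<and> (\<kappa> = 0 \<and> \<tau> \<noteq> 0 \<longrightarrow>
            \<not> (\<exists>f m l. 0 < m \<and> m \<le> \<infinity> \<and> quasi_einstein (Nil3 \<tau>) m l f))
       \<and> (\<kappa> < 0 \<and> \<tau> \<noteq> 0 \<longrightarrow>
            \<not> (\<exists>f m l. 0 < m \<and> m \<le> \<infinity> \<and> quasi_einstein (PSL2_cover \<kappa> \<tau>) m l f))"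
proof (intro conjI impI notI; elim exE conjE)
  fix f :: "(real \<times> real \<times> real) \<times> real \<Rightarrow> real" and m :: ereal and l :: real
  assume k: "\<kappa> > 0" and m: "0 < m" "(m, l) \<noteq> (\<infinity>, \<kappa>)"
    and qe: "quasi_einstein (S2_times_R \<kappa>) m l f"
  define h where "h = f \<circ> map_prod (stereo \<kappa> 1) id"
  have "Chart UNIV (map_prod (stereo \<kappa> 1) id) (cylinder_metric \<kappa>) \<in> S2_times_R \<kappa>"
    unfolding S2_times_R_eq[OF k] by blast
  from bspec[OF qe[unfolded quasi_einstein_def] this]
  have "smooth_on h UNIV" and eq: "ricci (cylinder_metric \<kappa>) x u v + hessian (cylinder_metric \<kappa>) h x u v
      - real_of_ereal (1 / m) * (dir_deriv h x u * dir_deriv h x v) = l * cylinder_metric \<kappa> x u v" for x u v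
    unfolding chart.sel h_def by blast+
  then show False
    using not_quasi_einstein_cylinder[OF k _ _ _ eq] real_of_ereal_inverse_nonneg[OF m(1)] m(2)
    by (auto simp: smooth_on_def)
next
  fix f :: "real \<times> real \<times> real \<Rightarrow> real" and m :: ereal and l :: real
  assume t: "\<tau> \<noteq> 0" and qe: "quasi_einstein (Nil3 \<tau>) m l f"
  then show False
    using not_quasi_einstein_bcv[of 1 0 "- \<tau>" f "real_of_ereal (1 / m)" l]
    unfolding quasi_einstein_def Nil3_def ball_simps chart.sel comp_id smooth_on_def
      bcv_dom_nil nil_metric_eq_bcv
    by (simp del: split_paired_All)
next
  fix f :: "real \<times> real \<times> real \<Rightarrow> real" and m :: ereal and l :: real
  assume k: "\<kappa> < 0" and t: "\<tau> \<noteq> 0" and qe: "quasi_einstein (PSL2_cover \<kappa> \<tau>) m l f"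
  then show False
    using not_quasi_einstein_bcv[of "1 / 2" "\<kappa> / 2" "2 * \<kappa> * \<tau>" f "real_of_ereal (1 / m)" l]
    unfolding quasi_einstein_def PSL2_cover_def ball_simps chart.sel comp_id smooth_on_def
      bcv_dom_psl2[symmetric] psl2_metric_eq_bcv
    by (simp del: split_paired_All)
qed

end
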